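(* Let $\gamma>1$ and $\phi=\frac{2}{1+\gamma}$. For $\lambda>0$ let $V_\lambda:\mathbb{R}_+\to\mathbb{R}_+$ be a solution of the ODE problem $$-V_\lambda''(t)=\left(V_\lambda(t)\right)^{-\gamma}\ \text{ for }t>0,\qquad V_\lambda'(t)\to\lambda\ \text{ as }t\to\infty,\qquad V_\lambda(0)=0.$$ Then for all $\lambda>0$ and $t>0$, $$V_\lambda(t)\sim\begin{cases}t^{\phi},&\text{if }t\le\lambda^{\frac{1+\gamma}{1-\gamma}},\\ \lambda t,&\text{if }t\ge\lambda^{\frac{1+\gamma}{1-\gamma}}.\end{cases}$$ In particular, for $\lambda\gtrsim1$ we have $V_\lambda(1)\sim\lambda$. Moreover, for all $\lambda>0$ and $t>0$, $$V_\lambda'(t)\sim\begin{cases}t^{\phi-1},&\text{if }t\le\lambda^{\frac{1+\gamma}{1-\gamma}},\\ \lambda,&\text{if }t\ge\lambda^{\frac{1+\gamma}{1-\gamma}}.\end{cases}$$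
   Context: $q_1\sim q_2$ means $C^{-1}q_2\le q_1\le Cq_2$ with a constant $C>0$ depending only on $\gamma$, not on $\lambda$ or $t$. "For $\lambda\gtrsim1$ we have $V_\lambda(1)\sim\lambda$" means: for every $c_0>0$, whenever $\lambda\ge c_0$, $V_\lambda(1)$ and $\lambda$ are comparable with a constant depending only on $\gamma$ and $c_0$. $V_\lambda$ is positive and $C^2$ on $(0,\infty)$ and continuous at $0$. *)

theory Defs
  imports "HOL-Analysis.Analysis"
begin

(* q1 ~ q2 with the constant C explicit, so that statements can say what C may depend on. *)
definition comparable :: "real \<Rightarrow> real \<Rightarrow> real \<Rightarrow> bool" where
  "comparable C q1 q2 \<longleftrightarrow> inverse C * q2 \<le> q1 \<and> q1 \<le> C * q2"

(* Only the values of V on [0, infinity) matter; since every t > 0 is an interior point of this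
   half-line, the two-sided derivatives at t > 0 do not see the values of V at negative
   arguments.  Continuity at 0 is therefore one-sided. *)
definition ode_solution :: "real \<Rightarrow> real \<Rightarrow> (real \<Rightarrow> real) \<Rightarrow> bool" where
  "ode_solution \<gamma> lam V \<longleftrightarrow>
     V 0 = 0 \<and>
     continuous (at 0 within {0..}) V \<and>
     (\<forall>t>0. V t > 0) \<and>
     (\<forall>t>0. V differentiable (at t)) \<and>
     (\<forall>t>0. deriv V differentiable (at t)) \<and>
     continuous_on {0<..} (deriv (deriv V)) \<and>
     (\<forall>t>0. - deriv (deriv V) t = V t powr (- \<gamma>)) \<and>
     (deriv V \<longlongrightarrow> lam) at_top"

end

theory Submission
  imports Defs
begin

text \<open>Since $V'$ decreases to $\lambda$, we have $V' \ge \lambda$ and $V \ge \lambda t$.  The energy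
  $V'^2 - \frac{2}{\gamma-1} V^{1-\gamma}$ is conserved and equals its limit $\lambda^2$ at infinity.
  Hence $V^{1/\phi}$ has derivative at least a positive constant, so $V \gtrsim t^\phi$; feeding this
  back into the energy identity gives $V' \le \lambda + C t^{\phi-1}$ and, by integration,
  $V \le \lambda t + C' t^\phi$.  The threshold $\lambda^{(1+\gamma)/(1-\gamma)}$ is the time at which
  $\lambda = t^{\phi-1}$.\<close>

lemma comparableI_bounds:
  assumes "m > 0" "q2 \<ge> 0" "m * q2 \<le> q1" "q1 \<le> M * q2" "inverse m \<le> C" "M \<le> C"
  shows "comparable C q1 q2"
proof -
  have "C > 0"
    using assms(1,5) by (meson less_le_trans positive_imp_inverse_positive)
  have "inverse C \<le> m"
    using le_imp_inverse_le[OF assms(5)] assms(1) by simp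
  then have "inverse C * q2 \<le> q1"
    using mult_right_mono[OF _ assms(2)] assms(3) by (meson order_trans)
  moreover have "q1 \<le> C * q2"
    using mult_right_mono[OF assms(6,2)] assms(4) by linarith
  ultimately show ?thesis
    by (simp add: comparable_def)
qed

lemma comparable_mono:
  assumes "comparable C q1 q2" "0 < C" "C \<le> D" "q2 \<ge> 0"
  shows "comparable D q1 q2"
  using assms by (intro comparableI_bounds[of "inverse C" _ _ C]) (auto simp: comparable_def)

locale emden_fowler =
  fixes \<gamma> lam :: real and V :: "real \<Rightarrow> real"
  assumes gamma: "\<gamma> > 1" and lam: "lam > 0" and sol: "ode_solution \<gamma> lam V"
begin

definition \<phi> :: real where "\<phi> = 2 / (1 + \<gamma>)"

definition \<kappa> :: real where "\<kappa> = sqrt (2 / (\<gamma> - 1))"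

lemma phi_pos: "\<phi> > 0" and phi_less_1: "\<phi> < 1"
  using gamma by (auto simp: \<phi>_def)

lemma phi_minus_1: "\<phi> - 1 = \<phi> * ((1 - \<gamma>) / 2)"
  using gamma by (simp add: \<phi>_def field_simps)

lemma kappa_pos: "\<kappa> > 0"
  using gamma by (simp add: \<kappa>_def)

lemma kappa_sq: "\<kappa>\<^sup>2 * (\<gamma> - 1) = 2"
  using gamma by (simp add: \<kappa>_def field_simps)

lemma V_pos: "t > 0 \<Longrightarrow> V t > 0"
  and V_0: "V 0 = 0"
  and deriv_V_lim: "(deriv V \<longlongrightarrow> lam) at_top"
  using sol by (auto simp: ode_solution_def)

lemma DERIV_V: "t > 0 \<Longrightarrow> (V has_real_derivative deriv V t) (at t)"
  using sol by (simp add: ode_solution_def DERIV_deriv_iff_real_differentiable)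

lemma DERIV_deriv_V: "t > 0 \<Longrightarrow> (deriv V has_real_derivative - (V t powr (- \<gamma>))) (at t)"
  using sol unfolding ode_solution_def
  by (metis DERIV_deriv_iff_real_differentiable minus_minus)

lemma continuous_on_V: "continuous_on {0..} V"
  unfolding continuous_on_eq_continuous_within
proof
  fix t :: real assume "t \<in> {0..}"
  show "continuous (at t within {0..}) V"
  proof (cases "t = 0")
    case True
    then show ?thesis using sol by (simp add: ode_solution_def)
  next
    case False
    then have "isCont V t"
      using \<open>t \<in> {0..}\<close> by (intro DERIV_isCont[OF DERIV_V]) simp
    then show ?thesis by (rule continuous_at_imp_continuous_at_within)
  qed
qed

lemma deriv_V_antimono: "0 < s \<Longrightarrow> s \<le> t \<Longrightarrow> deriv V t \<le> deriv V s"
  by (rule DERIV_nonpos_imp_nonincreasing[where f = "deriv V"])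
    (auto intro!: exI DERIV_deriv_V)

lemma deriv_V_ge: assumes "t > 0" shows "deriv V t \<ge> lam"
proof (rule tendsto_upperbound[OF deriv_V_lim])
  show "\<forall>\<^sub>F s in at_top. deriv V s \<le> deriv V t"
    using eventually_ge_at_top[of t] by eventually_elim (use assms deriv_V_antimono in auto)
qed simp

lemma V_ge_linear: assumes "t > 0" shows "V t \<ge> lam * t"
proof -
  have "V 0 - lam * 0 \<le> V t - lam * t"
  proof (rule DERIV_nonneg_imp_increasing_open[where a = 0 and b = t and
        f = "\<lambda>t. V t - lam * t"])
    show "continuous_on {0..t} (\<lambda>t. V t - lam * t)"
      by (intro continuous_intros continuous_on_subset[OF continuous_on_V]) auto
    show "\<exists>y. ((\<lambda>t. V t - lam * t) has_real_derivative y) (at s) \<and> 0 \<le> y"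
      if "0 < s" "s < t" for s
      using that deriv_V_ge[of s]
      by (intro exI[of _ "deriv V s - lam"]) (auto intro!: derivative_eq_intros DERIV_V)
  qed (use assms in simp)
  then show ?thesis by (simp add: V_0)
qed

lemma energy:
  assumes "t > 0"
  shows "(deriv V t)\<^sup>2 = lam\<^sup>2 + \<kappa>\<^sup>2 * V t powr (1 - \<gamma>)"
proof -
  define E where "E = (\<lambda>t. (deriv V t)\<^sup>2 - \<kappa>\<^sup>2 * V t powr (1 - \<gamma>))"
  have "(E has_real_derivative 0) (at s)" if "s > 0" for s
  proof -
    have "(E has_real_derivative 2 * deriv V s * - (V s powr - \<gamma>)
        - \<kappa>\<^sup>2 * ((1 - \<gamma>) * V s powr (- \<gamma>) * deriv V s)) (at s)"
      unfolding E_def using that V_pos[OF that]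
      by (auto intro!: derivative_eq_intros DERIV_V DERIV_deriv_V)
    also have "2 * deriv V s * - (V s powr - \<gamma>) - \<kappa>\<^sup>2 * ((1 - \<gamma>) * V s powr (- \<gamma>) * deriv V s)
        = (\<kappa>\<^sup>2 * (\<gamma> - 1) - 2) * (V s powr - \<gamma> * deriv V s)"
      by (simp add: algebra_simps)
    finally show ?thesis by (simp add: kappa_sq)
  qed
  then have "\<exists>c. \<forall>s\<in>{0<..}. E s = c"
    by (intro has_field_derivative_zero_constant) (auto intro: has_field_derivative_at_within)
  then have const: "E s = E t" if "s > 0" for s
    using assms that by auto
  have "filterlim (\<lambda>s. lam * s) at_top at_top"
    using lam by (simp add: filterlim_tendsto_pos_mult_at_top[OF tendsto_const] filterlim_ident)
  then have "filterlim V at_top at_top"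
    by (rule filterlim_at_top_mono)
      (use eventually_gt_at_top[of 0] in \<open>eventually_elim, simp add: V_ge_linear\<close>)
  then have "((\<lambda>s. V s powr (1 - \<gamma>)) \<longlongrightarrow> 0) at_top"
    using gamma by (intro tendsto_neg_powr) auto
  then have "(E \<longlongrightarrow> lam\<^sup>2 - \<kappa>\<^sup>2 * 0) at_top"
    unfolding E_def by (intro tendsto_intros deriv_V_lim)
  moreover have "(E \<longlongrightarrow> E t) at_top"
    by (rule tendsto_eventually, use eventually_gt_at_top[of 0] in eventually_elim) (rule const)
  ultimately have "E t = lam\<^sup>2"
    using tendsto_unique[of at_top E] by simp
  then show ?thesis by (simp add: E_def)
qed

lemma powr_half_sq: "(x powr ((1 - \<gamma>) / 2))\<^sup>2 = x powr (1 - \<gamma>)" if "x > 0" for x :: real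
  using that by (simp add: power2_eq_square flip: powr_add)

lemma deriv_V_ge_powr:
  assumes "t > 0"
  shows "deriv V t \<ge> \<kappa> * V t powr ((1 - \<gamma>) / 2)"
proof (rule power2_le_imp_le)
  show "(\<kappa> * V t powr ((1 - \<gamma>) / 2))\<^sup>2 \<le> (deriv V t)\<^sup>2"
    unfolding energy[OF assms] power_mult_distrib powr_half_sq[OF V_pos[OF assms]] by simp
  show "deriv V t \<ge> 0" using deriv_V_ge[OF assms] lam by linarith
qed

lemma deriv_V_le_powr:
  assumes "t > 0"
  shows "deriv V t \<le> lam + \<kappa> * V t powr ((1 - \<gamma>) / 2)"
proof (rule power2_le_imp_le)
  show "(deriv V t)\<^sup>2 \<le> (lam + \<kappa> * V t powr ((1 - \<gamma>) / 2))\<^sup>2"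
    unfolding energy[OF assms] power2_sum power_mult_distrib powr_half_sq[OF V_pos[OF assms]]
    using lam kappa_pos by simp
  show "lam + \<kappa> * V t powr ((1 - \<gamma>) / 2) \<ge> 0"
    using lam kappa_pos by simp
qed

definition a :: real where "a = (\<kappa> / \<phi>) powr \<phi>"

lemma a_pos: "a > 0"
  using kappa_pos phi_pos by (simp add: a_def)

lemma V_ge_powr:
  assumes "t > 0"
  shows "V t \<ge> a * t powr \<phi>"
proof -
  have "V 0 powr (1 / \<phi>) - \<kappa> / \<phi> * 0 \<le> V t powr (1 / \<phi>) - \<kappa> / \<phi> * t"
  proof (rule DERIV_nonneg_imp_increasing_open[where a = 0 and b = t and
        f = "\<lambda>t. V t powr (1 / \<phi>) - \<kappa> / \<phi> * t"])
    have nonneg: "V s \<ge> 0" if "s \<ge> 0" for s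
      using V_pos[of s] V_0 that by (cases "s = 0") auto
    have "continuous_on {0..t} (\<lambda>t. V t powr (1 / \<phi>))"
      by (rule continuous_on_powr'[OF continuous_on_subset[OF continuous_on_V] continuous_on_const])
        (use nonneg phi_pos in auto)
    then show "continuous_on {0..t} (\<lambda>t. V t powr (1 / \<phi>) - \<kappa> / \<phi> * t)"
      by (intro continuous_on_diff continuous_on_mult_const continuous_on_id)
    show "\<exists>y. ((\<lambda>t. V t powr (1 / \<phi>) - \<kappa> / \<phi> * t) has_real_derivative y) (at s) \<and> 0 \<le> y"
      if "0 < s" "s < t" for s
    proof (intro exI conjI)
      note pos = V_pos[OF \<open>0 < s\<close>]
      show "((\<lambda>t. V t powr (1 / \<phi>) - \<kappa> / \<phi> * t) has_real_derivative
          1 / \<phi> * V s powr (1 / \<phi> - 1) * deriv V s - \<kappa> / \<phi>) (at s)"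
        using pos phi_pos \<open>0 < s\<close> by (auto intro!: derivative_eq_intros DERIV_V)
      have "1 / \<phi> - 1 + (1 - \<gamma>) / 2 = 0"
        using gamma by (simp add: \<phi>_def field_simps)
      then have "V s powr (1 / \<phi> - 1) * V s powr ((1 - \<gamma>) / 2) = 1"
        using pos by (simp flip: powr_add)
      then have "\<kappa> = V s powr (1 / \<phi> - 1) * (\<kappa> * V s powr ((1 - \<gamma>) / 2))"
        by (simp add: mult.left_commute)
      also have "\<dots> \<le> V s powr (1 / \<phi> - 1) * deriv V s"
        by (rule mult_left_mono[OF deriv_V_ge_powr[OF \<open>0 < s\<close>]]) simp
      finally show "0 \<le> 1 / \<phi> * V s powr (1 / \<phi> - 1) * deriv V s - \<kappa> / \<phi>"
        using phi_pos by (simp add: field_simps)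
    qed
  qed (use assms in simp)
  then have "(\<kappa> / \<phi> * t) powr \<phi> \<le> (V t powr (1 / \<phi>)) powr \<phi>"
    using assms kappa_pos phi_pos by (intro powr_mono2) (auto simp: V_0)
  then show ?thesis
    using phi_pos V_pos[OF assms] by (simp add: powr_powr a_def flip: powr_mult)
qed

definition b :: real where "b = \<kappa> * a powr ((1 - \<gamma>) / 2)"

lemma b_pos: "b > 0"
  using kappa_pos a_pos by (simp add: b_def)

lemma powr_half_mult: "(c * t powr \<phi>) powr ((1 - \<gamma>) / 2) = c powr ((1 - \<gamma>) / 2) * t powr (\<phi> - 1)"
  if "c > 0" "t > 0" for c t :: real
  using that by (simp add: powr_mult powr_powr phi_minus_1)

lemma deriv_V_le:
  assumes "t > 0"
  shows "deriv V t \<le> lam + b * t powr (\<phi> - 1)"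
proof -
  have "V t powr ((1 - \<gamma>) / 2) \<le> (a * t powr \<phi>) powr ((1 - \<gamma>) / 2)"
    using gamma a_pos assms V_ge_powr by (intro powr_mono2') auto
  then have "\<kappa> * V t powr ((1 - \<gamma>) / 2) \<le> b * t powr (\<phi> - 1)"
    using kappa_pos assms a_pos by (simp add: b_def powr_half_mult)
  then show ?thesis using deriv_V_le_powr[OF assms] by linarith
qed

lemma V_le:
  assumes "t > 0"
  shows "V t \<le> lam * t + b / \<phi> * t powr \<phi>"
proof -
  have "lam * 0 + b / \<phi> * 0 powr \<phi> - V 0 \<le> lam * t + b / \<phi> * t powr \<phi> - V t"
  proof (rule DERIV_nonneg_imp_increasing_open[where a = 0 and b = t and
        f = "\<lambda>t. lam * t + b / \<phi> * t powr \<phi> - V t"])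
    show "continuous_on {0..t} (\<lambda>t. lam * t + b / \<phi> * t powr \<phi> - V t)"
      using phi_pos
      by (intro continuous_intros continuous_on_powr' continuous_on_subset[OF continuous_on_V]) auto
    show "\<exists>y. ((\<lambda>t. lam * t + b / \<phi> * t powr \<phi> - V t) has_real_derivative y) (at s) \<and> 0 \<le> y"
      if "0 < s" "s < t" for s
      using that deriv_V_le[of s] phi_pos
      by (intro exI[of _ "lam + b * s powr (\<phi> - 1) - deriv V s"])
        (auto intro!: derivative_eq_intros DERIV_V)
  qed (use assms in simp)
  then show ?thesis by (simp add: V_0)
qed

lemma lam_le_powr_iff:
  assumes "t > 0"
  shows "lam \<le> t powr (\<phi> - 1) \<longleftrightarrow> t \<le> lam powr ((1 + \<gamma>) / (1 - \<gamma>))"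
    and "t powr (\<phi> - 1) \<le> lam \<longleftrightarrow> lam powr ((1 + \<gamma>) / (1 - \<gamma>)) \<le> t"
proof -
  have e: "(1 + \<gamma>) / (1 - \<gamma>) = 1 / (\<phi> - 1)"
    using gamma by (simp add: \<phi>_def field_simps)
  define T where "T = lam powr ((1 + \<gamma>) / (1 - \<gamma>))"
  have T: "T > 0" "lam = T powr (\<phi> - 1)"
    using lam phi_less_1 by (auto simp: T_def e powr_powr)
  have anti: "y powr (\<phi> - 1) \<le> x powr (\<phi> - 1) \<longleftrightarrow> x \<le> y" if "x > 0" "y > 0" for x y :: real
    using that phi_less_1 powr_mono2'[of "\<phi> - 1" x y] powr_less_mono2_neg[of "\<phi> - 1" y x] by force
  show "lam \<le> t powr (\<phi> - 1) \<longleftrightarrow> t \<le> lam powr ((1 + \<gamma>) / (1 - \<gamma>))"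
    using anti[OF assms T(1)] by (simp only: T(2)[symmetric] T_def[symmetric])
  show "t powr (\<phi> - 1) \<le> lam \<longleftrightarrow> lam powr ((1 + \<gamma>) / (1 - \<gamma>)) \<le> t"
    using anti[OF T(1) assms] by (simp only: T(2)[symmetric] T_def[symmetric])
qed

lemma powr_phi_eq: "t > 0 \<Longrightarrow> t powr \<phi> = t powr (\<phi> - 1) * t" for t :: real
  by (simp add: powr_diff)

lemma comparable_V_small:
  assumes "t > 0" "t \<le> lam powr ((1 + \<gamma>) / (1 - \<gamma>))"
  shows "comparable (max (inverse a) (1 + b / \<phi>)) (V t) (t powr \<phi>)"
proof (rule comparableI_bounds[where m = a])
  have "lam * t \<le> t powr \<phi>"
    using assms lam_le_powr_iff(1) by (simp add: powr_phi_eq)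
  then show "V t \<le> (1 + b / \<phi>) * t powr \<phi>"
    using V_le[OF assms(1)] by (simp add: algebra_simps)
qed (use a_pos V_ge_powr assms in auto)

lemma comparable_V_large:
  assumes "t > 0" "t \<ge> lam powr ((1 + \<gamma>) / (1 - \<gamma>))"
  shows "comparable (1 + b / \<phi>) (V t) (lam * t)"
proof (rule comparableI_bounds[where m = 1])
  have "t powr \<phi> \<le> lam * t"
    using assms lam_le_powr_iff(2) by (simp add: powr_phi_eq)
  then have "b / \<phi> * t powr \<phi> \<le> b / \<phi> * (lam * t)"
    using b_pos phi_pos by (intro mult_left_mono) auto
  then show "V t \<le> (1 + b / \<phi>) * (lam * t)"
    using V_le[OF assms(1)] by (simp add: distrib_right)
qed (use b_pos phi_pos lam V_ge_linear assms in auto)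

lemma comparable_V_1:
  assumes "c > 0" "lam \<ge> c"
  shows "comparable (1 + b / \<phi> / c) (V 1) lam"
proof (rule comparableI_bounds[where m = 1])
  have "b / \<phi> * 1 \<le> b / \<phi> * (lam / c)"
    using b_pos phi_pos assms by (intro mult_left_mono) auto
  then show "V 1 \<le> (1 + b / \<phi> / c) * lam"
    using V_le[of 1] by (simp add: distrib_right)
qed (use b_pos phi_pos lam V_ge_linear[of 1] assms in auto)

lemma comparable_deriv_V_small:
  assumes "t > 0" "t \<le> lam powr ((1 + \<gamma>) / (1 - \<gamma>))"
  shows "comparable (max (inverse (\<kappa> * (1 + b / \<phi>) powr ((1 - \<gamma>) / 2))) (1 + b))
    (deriv V t) (t powr (\<phi> - 1))"
proof (rule comparableI_bounds[where m = "\<kappa> * (1 + b / \<phi>) powr ((1 - \<gamma>) / 2)"])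
  have le: "lam \<le> t powr (\<phi> - 1)"
    using assms lam_le_powr_iff(1) by simp
  then show "deriv V t \<le> (1 + b) * t powr (\<phi> - 1)"
    using deriv_V_le[OF assms(1)] by (simp add: algebra_simps)
  have pos: "1 + b / \<phi> > 0"
    using b_pos phi_pos by (simp add: add_pos_pos)
  then show "\<kappa> * (1 + b / \<phi>) powr ((1 - \<gamma>) / 2) > 0"
    using kappa_pos by simp
  have "lam * t \<le> t powr \<phi>"
    using le assms by (simp add: powr_phi_eq)
  then have "V t \<le> (1 + b / \<phi>) * t powr \<phi>"
    using V_le[OF assms(1)] by (simp add: algebra_simps)
  then have "((1 + b / \<phi>) * t powr \<phi>) powr ((1 - \<gamma>) / 2) \<le> V t powr ((1 - \<gamma>) / 2)"
    using gamma V_pos assms by (intro powr_mono2') auto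
  then have "\<kappa> * ((1 + b / \<phi>) powr ((1 - \<gamma>) / 2) * t powr (\<phi> - 1)) \<le> \<kappa> * V t powr ((1 - \<gamma>) / 2)"
    using kappa_pos assms pos by (simp add: powr_half_mult)
  then show "\<kappa> * (1 + b / \<phi>) powr ((1 - \<gamma>) / 2) * t powr (\<phi> - 1) \<le> deriv V t"
    using deriv_V_ge_powr[OF assms(1)] by (simp add: mult.assoc)
qed auto

lemma comparable_deriv_V_large:
  assumes "t > 0" "t \<ge> lam powr ((1 + \<gamma>) / (1 - \<gamma>))"
  shows "comparable (1 + b) (deriv V t) lam"
proof (rule comparableI_bounds[where m = 1])
  have "b * t powr (\<phi> - 1) \<le> b * lam"
    using b_pos assms lam_le_powr_iff(2) by (intro mult_left_mono) auto
  then show "deriv V t \<le> (1 + b) * lam"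
    using deriv_V_le[OF assms(1)] by (simp add: distrib_right)
qed (use b_pos lam deriv_V_ge assms in auto)

end

theorem lemma3p3:
  fixes \<gamma> \<phi> :: real
  assumes "\<gamma> > 1"
    and "\<phi> = 2 / (1 + \<gamma>)"
  shows
    "(\<exists>C>0. \<forall>lam>0. \<forall>V. ode_solution \<gamma> lam V \<longrightarrow> (\<forall>t>0.
        (t \<le> lam powr ((1 + \<gamma>) / (1 - \<gamma>)) \<longrightarrow> comparable C (V t) (t powr \<phi>)) \<and>
        (t \<ge> lam powr ((1 + \<gamma>) / (1 - \<gamma>)) \<longrightarrow> comparable C (V t) (lam * t))))
     \<and> (\<forall>c\<^sub>0>0. \<exists>C>0. \<forall>lam\<ge>c\<^sub>0. \<forall>V. ode_solution \<gamma> lam V \<longrightarrow> comparable C (V 1) lam)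
     \<and> (\<exists>C>0. \<forall>lam>0. \<forall>V. ode_solution \<gamma> lam V \<longrightarrow> (\<forall>t>0.
        (t \<le> lam powr ((1 + \<gamma>) / (1 - \<gamma>)) \<longrightarrow> comparable C (deriv V t) (t powr (\<phi> - 1))) \<and>
        (t \<ge> lam powr ((1 + \<gamma>) / (1 - \<gamma>)) \<longrightarrow> comparable C (deriv V t) lam)))"
proof (intro conjI)
  define B where "B = emden_fowler.b \<gamma>"
  define C1 where "C1 = Max {1, inverse (emden_fowler.a \<gamma>), 1 + B / \<phi>}"
  define C2 where
    "C2 = Max {1, inverse (emden_fowler.\<kappa> \<gamma> * (1 + B / \<phi>) powr ((1 - \<gamma>) / 2)), 1 + B}"
  show "\<exists>C>0. \<forall>lam>0. \<forall>V. ode_solution \<gamma> lam V \<longrightarrow> (\<forall>t>0.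
      (t \<le> lam powr ((1 + \<gamma>) / (1 - \<gamma>)) \<longrightarrow> comparable C (V t) (t powr \<phi>)) \<and>
      (t \<ge> lam powr ((1 + \<gamma>) / (1 - \<gamma>)) \<longrightarrow> comparable C (V t) (lam * t)))"
  proof (intro exI[of _ C1] conjI allI impI)
    show "C1 > 0" by (simp add: C1_def less_max_iff_disj)
    fix lam t :: real and V
    assume "lam > 0" "ode_solution \<gamma> lam V" "t > 0"
    then interpret emden_fowler \<gamma> lam V by unfold_locales (use assms in auto)
    have phi: "emden_fowler.\<phi> \<gamma> = \<phi>" by (simp add: \<phi>_def assms)
    note V_small = comparable_V_small[OF \<open>t > 0\<close>, unfolded phi]
    note V_large = comparable_V_large[OF \<open>t > 0\<close>, unfolded phi]
    show "comparable C1 (V t) (t powr \<phi>)" if "t \<le> lam powr ((1 + \<gamma>) / (1 - \<gamma>))"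
      by (rule comparable_mono[OF V_small[OF that]])
        (use a_pos in \<open>auto simp: C1_def B_def less_max_iff_disj\<close>)
    show "comparable C1 (V t) (lam * t)" if "t \<ge> lam powr ((1 + \<gamma>) / (1 - \<gamma>))"
      by (rule comparable_mono[OF V_large[OF that]])
        (use b_pos phi_pos \<open>t > 0\<close> lam in \<open>auto simp: C1_def B_def phi add_pos_pos\<close>)
  qed
  show "\<forall>c\<^sub>0>0. \<exists>C>0. \<forall>lam\<ge>c\<^sub>0. \<forall>V. ode_solution \<gamma> lam V \<longrightarrow> comparable C (V 1) lam"
  proof (intro allI impI)
    fix c\<^sub>0 :: real assume "c\<^sub>0 > 0"
    show "\<exists>C>0. \<forall>lam\<ge>c\<^sub>0. \<forall>V. ode_solution \<gamma> lam V \<longrightarrow> comparable C (V 1) lam"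
    proof (intro exI[of _ "max 1 (1 + B / \<phi> / c\<^sub>0)"] conjI allI impI)
      fix lam V assume "lam \<ge> c\<^sub>0" "ode_solution \<gamma> lam V"
      then interpret emden_fowler \<gamma> lam V
        by unfold_locales (use assms \<open>c\<^sub>0 > 0\<close> in auto)
      have phi: "emden_fowler.\<phi> \<gamma> = \<phi>" by (simp add: \<phi>_def assms)
      show "comparable (max 1 (1 + B / \<phi> / c\<^sub>0)) (V 1) lam"
        by (rule comparable_mono[OF comparable_V_1[OF \<open>c\<^sub>0 > 0\<close> \<open>lam \<ge> c\<^sub>0\<close>]])
          (use b_pos phi_pos \<open>c\<^sub>0 > 0\<close> lam in \<open>auto simp: B_def phi add_pos_pos\<close>)
    qed simp
  qed
  show "\<exists>C>0. \<forall>lam>0. \<forall>V. ode_solution \<gamma> lam V \<longrightarrow> (\<forall>t>0.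
      (t \<le> lam powr ((1 + \<gamma>) / (1 - \<gamma>)) \<longrightarrow> comparable C (deriv V t) (t powr (\<phi> - 1))) \<and>
      (t \<ge> lam powr ((1 + \<gamma>) / (1 - \<gamma>)) \<longrightarrow> comparable C (deriv V t) lam))"
  proof (intro exI[of _ C2] conjI allI impI)
    show "C2 > 0" by (simp add: C2_def less_max_iff_disj)
    fix lam t :: real and V
    assume "lam > 0" "ode_solution \<gamma> lam V" "t > 0"
    then interpret emden_fowler \<gamma> lam V by unfold_locales (use assms in auto)
    have phi: "emden_fowler.\<phi> \<gamma> = \<phi>" by (simp add: \<phi>_def assms)
    note V_small = comparable_deriv_V_small[OF \<open>t > 0\<close>, unfolded phi]
    note V_large = comparable_deriv_V_large[OF \<open>t > 0\<close>]
    show "comparable C2 (deriv V t) (t powr (\<phi> - 1))" if "t \<le> lam powr ((1 + \<gamma>) / (1 - \<gamma>))"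
      by (rule comparable_mono[OF V_small[OF that]])
        (use b_pos in \<open>auto simp: C2_def B_def less_max_iff_disj\<close>)
    show "comparable C2 (deriv V t) lam" if "t \<ge> lam powr ((1 + \<gamma>) / (1 - \<gamma>))"
      by (rule comparable_mono[OF V_large[OF that]])
        (use b_pos lam in \<open>auto simp: C2_def B_def\<close>)
  qed
qed

end
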